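(* The SCS-feasible warm-start algorithm described in the context evaluates the $|N|$ singleton values $V(\{i\})$ during initialization. From the end of initialization onward it maintains a pair $(CS^*,\tilde v)$ encoding an SCS, and returns that pair whenever it stops, for any budgets $T_1,T_2\ge0$. Beyond initialization it performs at most $\binom{|N|+1}{3}$ Core checks, and each check on a coalition of size at most $\tau$ evaluates at most $2^\tau-2$ coalition values.
   Context: **Game.** $N$ is a finite player set, $R$ a finite item set, $I_j\subseteq N$ the set of players for whom item $j$ is available, $R_i=\{j\in R:i\in I_j\}$. Data: profits $p^i_j\ge0$, weights $a_j>0$, budgets $b^i$, capacities $u^i_j\ge 0$, private constraints $B^ix^i\le d^i$, pooling parameter $\alpha\in(0,1]$. For $c\subseteq N$ let $I^c_j=I_j\cap c$, $R^c=\{j:I^c_j\ne\emptyset\}$, $R^c_{\mathrm{ind}}=\{j\in R^c:|I^c_j|=1\}$, $R^c_{\mathrm{com}}=\{j\in R^c:|I^c_j|\ge2\}$. With variables $x^i=(x^i_j)_{j\in R_i}$ for $i\in c$ and $y^c_j$ for $j\in R^c_{\mathrm{com}}$, $V(c)$ is the maximum of $\sum_{j\in R^c}\sum_{i\in I^c_j}p^i_jx^i_j$ subject to: $\sum_{j\in R^c_{\mathrm{com}}}a_jy^c_j+\sum_{j\in R^c_{\mathrm{ind}}}\sum_{i\in I^c_j}a_jx^i_j\le\sum_{i\in c}b^i$; $y^c_j=\sum_{i\in I^c_j}x^i_j$ for $j\in R^c_{\mathrm{com}}$; $B^ix^i\le d^i$ for $i\in c$; $0\le x^i_j\le u^i_j$;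 $0\le y^c_j\le\alpha\sum_{i\in I^c_j}u^i_j$, $y^c_j\in\mathbb Z_+$ for $j\in R^c_{\mathrm{com}}$; $x^i_j\in\mathbb Z_+$ for $j\in R^c_{\mathrm{ind}}$. $V(\emptyset)=0$. Every program is feasible and bounded, the zero plan is feasible for every program, and the private constraints do not tie a member's common items to its other decisions. **Stability.** The Core of the game restricted to $c$ is the set of $(w_i)_{i\in c}$ with $\sum_{i\in c}w_i=V(c)$ and $\sum_{i\in s}w_i\ge V(s)$ for all $s\subseteq c$. A partition $CS$ of $N$ with $v\in\mathbb R^N$ is a stable coalition structure (SCS) if for each $c\in CS$ the restriction of $v$ to $c$ lies in that Core. **Core check** $\mathrm{CoreNonempty}(c)$. If $|c|\le\tau$: evaluate $V(s)$ for all proper nonempty $s\subset c$ and decide by linear programming whether the Core of the game restricted to $c$ is nonempty. If $|c|>\tau$: row generation — solve the Core LP with only the subcoalition constraints found so far, find $s\subseteq c$ maximizing $V(s)-\sum_{i\in s}w_i$ at the resulting allocation $w$, and add that constraint if it is violated; stop with answer true if no violation exists (Core nonempty), or with answer false if the LP is infeasible (Core empty). If the time budget expires first the answer is "inconclusive" and is treated as a failure (not true). **Algorithm** (inputs: $N$, threshold $\tau$, time budgets $T_1,T_2$). Initialization: evaluate $V(\{i\})$ for all $i\in N$; set $CS=\{\{i\}:i\in N\}$, pool $\mathcal P=\{\{i\}:i\in N\}$, incumbent $(CS^*,\tilde v)=(CS,(V(\{i\}))_{i\in N})$. Phase 1 (stopped when budget $T_1$ is exhausted): while $|CS|\ge2$,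 let $\mathcal C$ be the set of unordered pairs $\{c_1,c_2\}\subseteq CS$ with gain $V(c_1\cup c_2)-V(c_1)-V(c_2)>0$; if $\mathcal C=\emptyset$, end the phase; for each pair in $\mathcal C$ in order of decreasing gain, run $\mathrm{CoreNonempty}(c_1\cup c_2)$ and, if it returns true, add $c_1\cup c_2$ to $\mathcal P$; if no pair passed, end the phase; otherwise replace in $CS$ the passing pair of largest gain by its union. Phase 2 (stopped when budget $T_2$ is exhausted): let $CS'\subseteq\mathcal P$ be the best solution found of the set partitioning problem $\max\sum_{c\in\mathcal P}V(c)\chi_c$ s.t. $\sum_{c\in\mathcal P:\,i\in c}\chi_c=1$ for all $i\in N$, $\chi_c\in\{0,1\}$, seeded with the singleton partition. If a Core allocation is obtained for every $c\in CS'$, forming a payoff vector $\tilde v'$, set $(CS^*,\tilde v)=(CS',\tilde v')$; otherwise leave the incumbent unchanged. Return $(CS^*,\tilde v)$. "Core checks" counts calls of $\mathrm{CoreNonempty}$. Linear programs are solved exactly. *)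

theory Defs
  imports Complex_Main "HOL-Library.Disjoint_Sets"
begin

section \<open>The pooling game\<close>

text \<open>
  The private constraints \<open>B\<^sup>i x\<^sup>i \<le> d\<^sup>i\<close> of player \<open>i\<close> are given by the rows
  \<open>r < private_rows i\<close> of \<open>private_matrix i\<close> and \<open>private_rhs i\<close>; the columns are the items.
\<close>

record ('i, 'j) game =
  players :: "'i set"
  items :: "'j set"
  available :: "'j \<Rightarrow> 'i set"
  profit :: "'i \<Rightarrow> 'j \<Rightarrow> real"
  weight :: "'j \<Rightarrow> real"
  budget :: "'i \<Rightarrow> real"
  capacity :: "'i \<Rightarrow> 'j \<Rightarrow> real"
  private_rows :: "'i \<Rightarrow> nat"
  private_matrix :: "'i \<Rightarrow> nat \<Rightarrow> 'j \<Rightarrow> real"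
  private_rhs :: "'i \<Rightarrow> nat \<Rightarrow> real"
  pooling :: real

definition items_of :: "('i, 'j) game \<Rightarrow> 'i \<Rightarrow> 'j set" where
  "items_of G i = {j \<in> items G. i \<in> available G j}"

definition avail_in :: "('i, 'j) game \<Rightarrow> 'i set \<Rightarrow> 'j \<Rightarrow> 'i set" where
  "avail_in G c j = available G j \<inter> c"

definition coalition_items :: "('i, 'j) game \<Rightarrow> 'i set \<Rightarrow> 'j set" where
  "coalition_items G c = {j \<in> items G. avail_in G c j \<noteq> {}}"

definition individual_items :: "('i, 'j) game \<Rightarrow> 'i set \<Rightarrow> 'j set" where
  "individual_items G c = {j \<in> coalition_items G c. card (avail_in G c j) = 1}"

definition common_items :: "('i, 'j) game \<Rightarrow> 'i set \<Rightarrow> 'j set" where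
  "common_items G c = {j \<in> coalition_items G c. card (avail_in G c j) \<ge> 2}"

definition private_feasible :: "('i, 'j) game \<Rightarrow> 'i \<Rightarrow> ('j \<Rightarrow> real) \<Rightarrow> bool" where
  "private_feasible G i x \<longleftrightarrow>
     (\<forall>r < private_rows G i. (\<Sum>j\<in>items_of G i. private_matrix G i r j * x j) \<le> private_rhs G i r)"

text \<open>
  Plans are total functions; the program of \<open>c\<close> reads \<open>x i j\<close> only for \<open>i \<in> c\<close>,
  \<open>j \<in> items_of G i\<close>, and \<open>y j\<close> only for the common items of \<open>c\<close>.
\<close>

definition feasible :: "('i, 'j) game \<Rightarrow> 'i set \<Rightarrow> ('i \<Rightarrow> 'j \<Rightarrow> real) \<Rightarrow> ('j \<Rightarrow> real) \<Rightarrow> bool" where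
  "feasible G c x y \<longleftrightarrow>
     (\<Sum>j\<in>common_items G c. weight G j * y j)
       + (\<Sum>j\<in>individual_items G c. \<Sum>i\<in>avail_in G c j. weight G j * x i j)
       \<le> (\<Sum>i\<in>c. budget G i) \<and>
     (\<forall>j\<in>common_items G c. y j = (\<Sum>i\<in>avail_in G c j. x i j)) \<and>
     (\<forall>i\<in>c. private_feasible G i (x i)) \<and>
     (\<forall>i\<in>c. \<forall>j\<in>items_of G i. 0 \<le> x i j \<and> x i j \<le> capacity G i j) \<and>
     (\<forall>j\<in>common_items G c.
        0 \<le> y j \<and> y j \<le> pooling G * (\<Sum>i\<in>avail_in G c j. capacity G i j) \<and> y j \<in> \<nat>) \<and>
     (\<forall>j\<in>individual_items G c. \<forall>i\<in>avail_in G c j. x i j \<in> \<nat>)"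

definition total_profit :: "('i, 'j) game \<Rightarrow> 'i set \<Rightarrow> ('i \<Rightarrow> 'j \<Rightarrow> real) \<Rightarrow> real" where
  "total_profit G c x = (\<Sum>j\<in>coalition_items G c. \<Sum>i\<in>avail_in G c j. profit G i j * x i j)"

definition profits :: "('i, 'j) game \<Rightarrow> 'i set \<Rightarrow> real set" where
  "profits G c = {total_profit G c x | x y. feasible G c x y}"

definition coalition_value :: "('i, 'j) game \<Rightarrow> 'i set \<Rightarrow> real" where
  "coalition_value G c = (if c = {} then 0 else (GREATEST v. v \<in> profits G c))"

text \<open>
  The last assumption says that for each member \<open>i\<close> of a coalition \<open>c\<close> the set of privately
  feasible plans is a product of a set of plans for the common items of \<open>c\<close> and a set of plans
  for the remaining items of \<open>i\<close>.
\<close>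

locale pooling_game =
  fixes G :: "('i, 'j) game"
  assumes finite_players: "finite (players G)"
    and finite_items: "finite (items G)"
    and available_players: "j \<in> items G \<Longrightarrow> available G j \<subseteq> players G"
    and profit_nonneg: "j \<in> items G \<Longrightarrow> i \<in> available G j \<Longrightarrow> 0 \<le> profit G i j"
    and weight_pos: "j \<in> items G \<Longrightarrow> 0 < weight G j"
    and capacity_nonneg: "j \<in> items G \<Longrightarrow> i \<in> available G j \<Longrightarrow> 0 \<le> capacity G i j"
    and pooling_range: "0 < pooling G" "pooling G \<le> 1"
    and programs_feasible: "c \<subseteq> players G \<Longrightarrow> \<exists>x y. feasible G c x y"
    and programs_bounded: "c \<subseteq> players G \<Longrightarrow> bdd_above (profits G c)"
    and zero_feasible: "c \<subseteq> players G \<Longrightarrow> feasible G c (\<lambda>i j. 0) (\<lambda>j. 0)"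
    and private_untied: "c \<subseteq> players G \<Longrightarrow> i \<in> c \<Longrightarrow> private_feasible G i x \<Longrightarrow>
      private_feasible G i x' \<Longrightarrow>
      private_feasible G i (\<lambda>j. if j \<in> common_items G c then x j else x' j)"

section \<open>Stability\<close>

definition core :: "('i, 'j) game \<Rightarrow> 'i set \<Rightarrow> ('i \<Rightarrow> real) set" where
  "core G c = {w. (\<Sum>i\<in>c. w i) = coalition_value G c \<and>
                  (\<forall>s. s \<subseteq> c \<longrightarrow> (\<Sum>i\<in>s. w i) \<ge> coalition_value G s)}"

definition stable_structure :: "('i, 'j) game \<Rightarrow> 'i set set \<times> ('i \<Rightarrow> real) \<Rightarrow> bool" where
  "stable_structure G = (\<lambda>(CS, v). partition_on (players G) CS \<and> (\<forall>c\<in>CS. v \<in> core G c))"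

section \<open>The Core check\<close>

text \<open>The solutions of the Core LP of \<open>c\<close> restricted to the subcoalition constraints in \<open>S\<close>.\<close>

definition core_lp :: "('i, 'j) game \<Rightarrow> 'i set \<Rightarrow> 'i set set \<Rightarrow> ('i \<Rightarrow> real) set" where
  "core_lp G c S = {w. (\<Sum>i\<in>c. w i) = coalition_value G c \<and>
                       (\<forall>s\<in>S. (\<Sum>i\<in>s. w i) \<ge> coalition_value G s)}"

definition excess :: "('i, 'j) game \<Rightarrow> ('i \<Rightarrow> real) \<Rightarrow> 'i set \<Rightarrow> real" where
  "excess G w s = coalition_value G s - (\<Sum>i\<in>s. w i)"

definition most_violated :: "('i, 'j) game \<Rightarrow> 'i set \<Rightarrow> ('i \<Rightarrow> real) \<Rightarrow> 'i set \<Rightarrow> bool" where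
  "most_violated G c w s \<longleftrightarrow> s \<subseteq> c \<and> (\<forall>s'. s' \<subseteq> c \<longrightarrow> excess G w s' \<le> excess G w s)"

datatype answer = Yes | No | Inconclusive

text \<open>\<open>Running S\<close>: the constraints of the subcoalitions in \<open>S\<close> have been collected so far.\<close>

datatype 'i check_state = Running "'i set set" | Answered answer

text \<open>
  \<open>check_step G \<tau> c k es k'\<close>: the check on \<open>c\<close> moves from \<open>k\<close> to \<open>k'\<close>, evaluating
  the values of the coalitions listed in \<open>es\<close>.  The value of \<open>c\<close> itself is known to the caller,
  which has used it to compute a gain.  Expiry of the time budget is part of \<open>exec\<close> below.
\<close>

inductive check_step :: "('i, 'j) game \<Rightarrow> nat \<Rightarrow> 'i set \<Rightarrow>
    'i check_state \<Rightarrow> 'i set list \<Rightarrow> 'i check_state \<Rightarrow> bool"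
  for G :: "('i, 'j) game" and \<tau> :: nat and c :: "'i set" where
  enumerate: "card c \<le> \<tau> \<Longrightarrow> s \<noteq> {} \<Longrightarrow> s \<subset> c \<Longrightarrow> s \<notin> S \<Longrightarrow>
    check_step G \<tau> c (Running S) [s] (Running (insert s S))"
| enumerate_yes: "card c \<le> \<tau> \<Longrightarrow> (\<forall>s. s \<noteq> {} \<and> s \<subset> c \<longrightarrow> s \<in> S) \<Longrightarrow> core_lp G c S \<noteq> {} \<Longrightarrow>
    check_step G \<tau> c (Running S) [] (Answered Yes)"
| enumerate_no: "card c \<le> \<tau> \<Longrightarrow> (\<forall>s. s \<noteq> {} \<and> s \<subset> c \<longrightarrow> s \<in> S) \<Longrightarrow> core_lp G c S = {} \<Longrightarrow>
    check_step G \<tau> c (Running S) [] (Answered No)"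
| generate: "card c > \<tau> \<Longrightarrow> w \<in> core_lp G c S \<Longrightarrow> most_violated G c w s \<Longrightarrow> excess G w s > 0 \<Longrightarrow>
    check_step G \<tau> c (Running S) [s] (Running (insert s S))"
| generate_yes: "card c > \<tau> \<Longrightarrow> w \<in> core_lp G c S \<Longrightarrow> most_violated G c w s \<Longrightarrow> excess G w s \<le> 0 \<Longrightarrow>
    check_step G \<tau> c (Running S) [s] (Answered Yes)"
| generate_no: "card c > \<tau> \<Longrightarrow> core_lp G c S = {} \<Longrightarrow>
    check_step G \<tau> c (Running S) [] (Answered No)"

section \<open>The algorithm\<close>

definition singletons :: "('i, 'j) game \<Rightarrow> 'i set set" where
  "singletons G = {{i} | i. i \<in> players G}"

text \<open>The gain of an unordered pair \<open>{c1, c2}\<close>, represented as a set of two coalitions.\<close>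

definition gain :: "('i, 'j) game \<Rightarrow> 'i set set \<Rightarrow> real" where
  "gain G p = coalition_value G (\<Union>p) - (\<Sum>c\<in>p. coalition_value G c)"

definition candidates :: "('i, 'j) game \<Rightarrow> 'i set set \<Rightarrow> 'i set set set" where
  "candidates G CS = {p. p \<subseteq> CS \<and> card p = 2 \<and> gain G p > 0}"

text \<open>
  A 0/1-vector \<open>\<chi>\<close> over the pool \<open>P\<close> is represented by its support \<open>C\<close>.
\<close>

definition spp_feasible :: "('i, 'j) game \<Rightarrow> 'i set set \<Rightarrow> 'i set set \<Rightarrow> bool" where
  "spp_feasible G P C \<longleftrightarrow> C \<subseteq> P \<and>
     (\<forall>i\<in>players G. (\<Sum>c\<in>{c \<in> P. i \<in> c}. of_bool (c \<in> C)) = (1::nat))"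

definition spp_value :: "('i, 'j) game \<Rightarrow> 'i set set \<Rightarrow> 'i set set \<Rightarrow> real" where
  "spp_value G P C = (\<Sum>c\<in>P. coalition_value G c * of_bool (c \<in> C))"

text \<open>
  Control points:
  \<^item> \<open>Init A\<close>: the singleton values of the players in \<open>A\<close> are still to be evaluated.
  \<^item> \<open>Loop\<close>: head of the while loop of phase 1.
  \<^item> \<open>Pairs ps Q\<close>: within an iteration, the pairs \<open>ps\<close> are still to be checked, in this order,
    and those in \<open>Q\<close> have passed.
  \<^item> \<open>Checking p ps Q k\<close>: the check on the union of \<open>p\<close> is in state \<open>k\<close>.
  \<^item> \<open>Solving C\<close>: phase 2, \<open>C\<close> is the best set partitioning solution found so far.
  \<^item> \<open>Allocating C A v\<close>: phase 2, Core allocations are still missing for the coalitions \<open>A\<close>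
    of \<open>C\<close>; \<open>v\<close> collects the others.
  \<^item> \<open>Returned r\<close>: the algorithm has stopped and returned \<open>r\<close>.
\<close>

datatype 'i control =
    Init "'i set"
  | Loop
  | Pairs "'i set set list" "'i set set set"
  | Checking "'i set set" "'i set set list" "'i set set set" "'i check_state"
  | Solving "'i set set"
  | Allocating "'i set set" "'i set set" "'i \<Rightarrow> real"
  | Closing
  | Returned "'i set set \<times> ('i \<Rightarrow> real)"

text \<open>
  \<open>clock\<close> is the time spent in the current phase.  \<open>init_evals\<close> and \<open>checks\<close> are histories, most
  recent entry first: the coalition values evaluated during initialization, and for each call of
  the Core check its argument and the list of coalition values that this call has evaluated.
\<close>

record 'i state =
  control :: "'i control"
  clock :: real
  cur_structure :: "'i set set"
  pool :: "'i set set"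
  incumbent :: "'i set set \<times> ('i \<Rightarrow> real)"
  init_evals :: "'i set list"
  checks :: "('i set \<times> 'i set list) list"

definition start :: "('i, 'j) game \<Rightarrow> 'i state" where
  "start G = \<lparr>control = Init (players G), clock = 0, cur_structure = {}, pool = {},
     incumbent = undefined, init_evals = [], checks = []\<rparr>"

fun log_evals :: "'i set list \<Rightarrow> ('i set \<times> 'i set list) list \<Rightarrow> ('i set \<times> 'i set list) list" where
  "log_evals es [] = []"
| "log_evals es ((c, es') # cs) = (c, es @ es') # cs"

definition begin_phase2 :: "('i, 'j) game \<Rightarrow> 'i state \<Rightarrow> 'i state" where
  "begin_phase2 G \<sigma> = \<sigma>\<lparr>control := Solving (singletons G), clock := 0\<rparr>"

text \<open>
  Program steps are instantaneous; all time is spent in separate delays (see \<open>reachable\<close>), so an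
  operation cut off by a budget appears as a delay that exhausts the budget before the step is
  taken.  Steps of a phase are taken only while its budget lasts.  Choices left open by the
  algorithm (order of evaluations, ties, which LP solution, which improving partition) are
  nondeterministic.  How Core allocations are obtained in phase 2, and when this is given up,
  is left open too: the attempt may be abandoned as long as some allocation is missing.
\<close>

inductive exec :: "('i, 'j) game \<Rightarrow> nat \<Rightarrow> real \<Rightarrow> real \<Rightarrow> 'i state \<Rightarrow> 'i state \<Rightarrow> bool"
  for G :: "('i, 'j) game" and \<tau> :: nat and T1 :: real and T2 :: real where
  init_eval: "control \<sigma> = Init A \<Longrightarrow> i \<in> A \<Longrightarrow>
    exec G \<tau> T1 T2 \<sigma> (\<sigma>\<lparr>control := Init (A - {i}), init_evals := {i} # init_evals \<sigma>\<rparr>)"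
| init_done: "control \<sigma> = Init {} \<Longrightarrow>
    exec G \<tau> T1 T2 \<sigma> (\<sigma>\<lparr>control := Loop, clock := 0, cur_structure := singletons G,
      pool := singletons G, incumbent := (singletons G, \<lambda>i. coalition_value G {i})\<rparr>)"
| phase1_timeout: "control \<sigma> = Loop \<or> control \<sigma> = Pairs ps Q \<Longrightarrow> clock \<sigma> \<ge> T1 \<Longrightarrow>
    exec G \<tau> T1 T2 \<sigma> (begin_phase2 G \<sigma>)"
| loop_exit: "control \<sigma> = Loop \<Longrightarrow> clock \<sigma> < T1 \<Longrightarrow>
    card (cur_structure \<sigma>) < 2 \<or> candidates G (cur_structure \<sigma>) = {} \<Longrightarrow>
    exec G \<tau> T1 T2 \<sigma> (begin_phase2 G \<sigma>)"
| loop_enter: "control \<sigma> = Loop \<Longrightarrow> clock \<sigma> < T1 \<Longrightarrow>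
    card (cur_structure \<sigma>) \<ge> 2 \<Longrightarrow> candidates G (cur_structure \<sigma>) \<noteq> {} \<Longrightarrow>
    distinct ps \<Longrightarrow> set ps = candidates G (cur_structure \<sigma>) \<Longrightarrow>
    sorted_wrt (\<lambda>p q. gain G p \<ge> gain G q) ps \<Longrightarrow>
    exec G \<tau> T1 T2 \<sigma> (\<sigma>\<lparr>control := Pairs ps {}\<rparr>)"
| check_begin: "control \<sigma> = Pairs (p # ps) Q \<Longrightarrow> clock \<sigma> < T1 \<Longrightarrow>
    exec G \<tau> T1 T2 \<sigma> (\<sigma>\<lparr>control := Checking p ps Q (Running {}), checks := (\<Union>p, []) # checks \<sigma>\<rparr>)"
| check_continue: "control \<sigma> = Checking p ps Q k \<Longrightarrow> clock \<sigma> < T1 \<Longrightarrow>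
    check_step G \<tau> (\<Union>p) k es k' \<Longrightarrow>
    exec G \<tau> T1 T2 \<sigma> (\<sigma>\<lparr>control := Checking p ps Q k', checks := log_evals es (checks \<sigma>)\<rparr>)"
| check_timeout: "control \<sigma> = Checking p ps Q (Running S) \<Longrightarrow> clock \<sigma> \<ge> T1 \<Longrightarrow>
    exec G \<tau> T1 T2 \<sigma> (\<sigma>\<lparr>control := Checking p ps Q (Answered Inconclusive)\<rparr>)"
| check_passed: "control \<sigma> = Checking p ps Q (Answered Yes) \<Longrightarrow>
    exec G \<tau> T1 T2 \<sigma> (\<sigma>\<lparr>control := Pairs ps (insert p Q), pool := insert (\<Union>p) (pool \<sigma>)\<rparr>)"
| check_failed: "control \<sigma> = Checking p ps Q (Answered r) \<Longrightarrow> r \<noteq> Yes \<Longrightarrow>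
    exec G \<tau> T1 T2 \<sigma> (\<sigma>\<lparr>control := Pairs ps Q\<rparr>)"
| none_passed: "control \<sigma> = Pairs [] {} \<Longrightarrow> clock \<sigma> < T1 \<Longrightarrow>
    exec G \<tau> T1 T2 \<sigma> (begin_phase2 G \<sigma>)"
| merge: "control \<sigma> = Pairs [] Q \<Longrightarrow> clock \<sigma> < T1 \<Longrightarrow>
    p \<in> Q \<Longrightarrow> (\<forall>q\<in>Q. gain G q \<le> gain G p) \<Longrightarrow>
    exec G \<tau> T1 T2 \<sigma>
      (\<sigma>\<lparr>control := Loop, cur_structure := insert (\<Union>p) (cur_structure \<sigma> - p)\<rparr>)"
| spp_improve: "control \<sigma> = Solving C \<Longrightarrow> clock \<sigma> < T2 \<Longrightarrow>
    spp_feasible G (pool \<sigma>) C' \<Longrightarrow> spp_value G (pool \<sigma>) C < spp_value G (pool \<sigma>) C' \<Longrightarrow>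
    exec G \<tau> T1 T2 \<sigma> (\<sigma>\<lparr>control := Solving C'\<rparr>)"
| spp_done: "control \<sigma> = Solving C \<Longrightarrow>
    clock \<sigma> \<ge> T2 \<or>
    (\<forall>C'. spp_feasible G (pool \<sigma>) C' \<longrightarrow> spp_value G (pool \<sigma>) C' \<le> spp_value G (pool \<sigma>) C) \<Longrightarrow>
    exec G \<tau> T1 T2 \<sigma> (\<sigma>\<lparr>control := Allocating C C (\<lambda>i. 0)\<rparr>)"
| allocate: "control \<sigma> = Allocating C A v \<Longrightarrow> c \<in> A \<Longrightarrow> w \<in> core G c \<Longrightarrow>
    exec G \<tau> T1 T2 \<sigma> (\<sigma>\<lparr>control := Allocating C (A - {c}) (\<lambda>i. if i \<in> c then w i else v i)\<rparr>)"
| allocate_done: "control \<sigma> = Allocating C {} v \<Longrightarrow>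
    exec G \<tau> T1 T2 \<sigma> (\<sigma>\<lparr>control := Closing, incumbent := (C, v)\<rparr>)"
| allocate_abandon: "control \<sigma> = Allocating C A v \<Longrightarrow> A \<noteq> {} \<Longrightarrow>
    exec G \<tau> T1 T2 \<sigma> (\<sigma>\<lparr>control := Closing\<rparr>)"
| return: "control \<sigma> = Closing \<Longrightarrow>
    exec G \<tau> T1 T2 \<sigma> (\<sigma>\<lparr>control := Returned (incumbent \<sigma>)\<rparr>)"

inductive reachable :: "('i, 'j) game \<Rightarrow> nat \<Rightarrow> real \<Rightarrow> real \<Rightarrow> 'i state \<Rightarrow> bool"
  for G :: "('i, 'j) game" and \<tau> :: nat and T1 :: real and T2 :: real where
  reach_start: "reachable G \<tau> T1 T2 (start G)"
| reach_exec: "reachable G \<tau> T1 T2 \<sigma> \<Longrightarrow> exec G \<tau> T1 T2 \<sigma> \<sigma>' \<Longrightarrow> reachable G \<tau> T1 T2 \<sigma>'"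
| reach_delay: "reachable G \<tau> T1 T2 \<sigma> \<Longrightarrow> \<delta> \<ge> 0 \<Longrightarrow>
    reachable G \<tau> T1 T2 (\<sigma>\<lparr>clock := clock \<sigma> + \<delta>\<rparr>)"

definition initialized :: "'i state \<Rightarrow> bool" where
  "initialized \<sigma> \<longleftrightarrow> (\<nexists>A. control \<sigma> = Init A)"

definition stopped :: "('i, 'j) game \<Rightarrow> nat \<Rightarrow> real \<Rightarrow> real \<Rightarrow> 'i state \<Rightarrow> bool" where
  "stopped G \<tau> T1 T2 \<sigma> \<longleftrightarrow> (\<nexists>\<sigma>'. exec G \<tau> T1 T2 \<sigma> \<sigma>')"

end

theory Submission
  imports Defs
begin

text \<open>
  While \<open>m\<close> coalitions remain, an iteration of phase 1 performs at most \<open>m choose 2\<close> checks and then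
  either ends the phase or merges two coalitions, so
  \<open>checks + (m + 1 choose 3)\<close> never increases, because
  \<open>(m + 1 choose 3) = (m choose 2) + (m choose 3)\<close>.
  A check by enumeration never evaluates a proper nonempty subcoalition twice.  The pool only ever
  contains nonempty coalitions, so the feasible points of the set partitioning problem are
  partitions of the players; the incumbent is replaced only once each block of such a partition has
  received a Core allocation, and allocations on disjoint blocks do not interfere.
\<close>

section \<open>Core allocations and the count of proper nonempty subcoalitions\<close>

text \<open>Only the payoffs of members of \<open>c\<close> enter the Core conditions, so
  allocations chosen separately on disjoint blocks can be glued together.\<close>

lemma core_cong:
  assumes "\<And>i. i \<in> c \<Longrightarrow> v i = w i"
  shows "v \<in> core G c \<longleftrightarrow> w \<in> core G c"
proof -
  have "sum v s = sum w s" if "s \<subseteq> c" for s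
    using assms that by (intro sum.cong) auto
  then show ?thesis
    unfolding core_def by auto
qed

lemma card_proper_nonempty_subsets:
  assumes "finite c" "c \<noteq> {}"
  shows "int (card {s. s \<noteq> {} \<and> s \<subset> c}) = 2 ^ card c - 2"
proof -
  have eq: "{s. s \<noteq> {} \<and> s \<subset> c} = Pow c - {{}, c}"
    by auto
  have "card {s. s \<noteq> {} \<and> s \<subset> c} = card (Pow c) - card {{}, c}"
    unfolding eq using assms by (intro card_Diff_subset) auto
  moreover have "card {{}, c} = 2"
    using assms by auto
  moreover have "card {{}, c} \<le> card (Pow c)"
    using assms by (intro card_mono) auto
  ultimately show ?thesis
    using assms by (simp add: card_Pow of_nat_diff)
qed

text \<open>Over \<open>int\<close> the bound is -1 at \<open>k = 0\<close>, a case excluded because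
  a finite nonempty \<open>c\<close> has at least one member. With \<open>S = {}\<close> the lemma
  says that the bound is nonnegative.\<close>

lemma card_proper_nonempty_subsets_le:
  assumes "finite c" "c \<noteq> {}" "card c \<le> k" "S \<subseteq> {s. s \<noteq> {} \<and> s \<subset> c}"
  shows "int (card S) \<le> 2 ^ k - 2"
proof -
  have "finite {s. s \<noteq> {} \<and> s \<subset> c}"
    using \<open>finite c\<close> by (auto intro: finite_subset[of _ "Pow c"])
  then have "int (card S) \<le> int (card {s. s \<noteq> {} \<and> s \<subset> c})"
    using assms by (simp add: card_mono)
  also have "\<dots> = 2 ^ card c - 2"
    using assms by (intro card_proper_nonempty_subsets)
  also have "\<dots> \<le> 2 ^ k - 2"
    using assms by (simp add: power_increasing)
  finally show ?thesis .
qed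

lemma exists_max_on_finite:
  fixes f :: "'a \<Rightarrow> real"
  assumes "finite A" "A \<noteq> {}"
  shows "\<exists>x\<in>A. \<forall>y\<in>A. f y \<le> f x"
proof -
  have "Max (f ` A) \<in> f ` A"
    using assms by simp
  then obtain x where "x \<in> A" "Max (f ` A) = f x"
    by auto
  then show ?thesis
    using assms by (metis Max_ge finite_imageI imageI)
qed

section \<open>Candidate pairs and merging\<close>

lemma candidates_finite: "finite CS \<Longrightarrow> finite (candidates G CS)"
  unfolding candidates_def by (auto intro: finite_subset[of _ "Pow CS"])

lemma card_candidates_le:
  assumes "finite CS"
  shows "card (candidates G CS) \<le> card CS choose 2"
proof -
  have "card (candidates G CS) \<le> card {p. p \<subseteq> CS \<and> card p = 2}"
    unfolding candidates_def using assms
    by (intro card_mono) (auto intro: finite_subset[of _ "Pow CS"])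
  then show ?thesis
    using assms by (simp add: n_subsets)
qed

text \<open>Two coalitions leave and at most one enters, since \<open>C\<close> may already lie in
  \<open>CS - p\<close>.\<close>

lemma card_merge_less:
  assumes "finite CS" "p \<in> candidates G CS"
  shows "card (insert C (CS - p)) < card CS"
proof -
  have p: "p \<subseteq> CS" "card p = 2"
    using assms(2) by (auto simp: candidates_def)
  then have "card (CS - p) = card CS - 2" "2 \<le> card CS"
    using assms(1) by (auto simp: card_Diff_subset finite_subset card_mono dest: card_mono[OF assms(1)])
  moreover have "card (insert C (CS - p)) \<le> Suc (card (CS - p))"
    by (rule card_insert_le_m1[THEN order_trans]) auto
  ultimately show ?thesis
    by linarith
qed

section \<open>Set partitioning and the singleton structure\<close>

text \<open>The 0/1 sum in each constraint counts the chosen coalitions that contain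
  \<open>i\<close>, so there is exactly one. Existence gives covering, uniqueness gives
  disjointness, and nonemptiness is inherited from the pool.\<close>

lemma spp_feasible_partition:
  assumes "finite P" "P \<subseteq> Pow (players G) - {{}}" "spp_feasible G P C"
  shows "partition_on (players G) C"
proof (rule partition_onI)
  have unique: "\<exists>!c. c \<in> C \<and> i \<in> c" if "i \<in> players G" for i
  proof -
    have "(\<Sum>c\<in>{c \<in> P. i \<in> c}. of_bool (c \<in> C)) = card {c \<in> C. i \<in> c}"
    proof -
      have "{c \<in> P. i \<in> c} \<inter> {c. c \<in> C} = {c \<in> C. i \<in> c}"
        using assms(3) by (auto simp: spp_feasible_def)
      then show ?thesis
        using assms(1) by (simp add: sum_of_bool_eq)
    qed
    then have "card {c \<in> C. i \<in> c} = 1"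
      using assms(3) that by (auto simp: spp_feasible_def)
    then obtain d where "{c \<in> C. i \<in> c} = {d}"
      by (auto simp: card_1_singleton_iff)
    then show ?thesis
      by (metis (mono_tags, lifting) mem_Collect_eq singletonD singletonI)
  qed
  have sub: "C \<subseteq> Pow (players G) - {{}}"
    using assms by (auto simp: spp_feasible_def)
  show "\<Union>C = players G"
    using sub unique by blast
  show "{} \<notin> C"
    using sub by auto
  \<comment> \<open>A common element would be a player, as \<open>C\<close> consists of subsets of
    \<open>players G\<close>, and would then lie in two chosen coalitions.\<close>
  show "disjnt c d" if "c \<in> C" "d \<in> C" "c \<noteq> d" for c d
    using that sub unique unfolding disjnt_def by blast
qed

lemma partition_on_singletons: "partition_on (players G) (singletons G)"
  unfolding singletons_def by (rule partition_onI) (auto simp: disjnt_def)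

lemma singletons_eq_image: "singletons G = (\<lambda>i. {i}) ` players G"
  unfolding singletons_def by auto

text \<open>The only subcoalitions of \<open>{i}\<close> are \<open>{}\<close> and
  \<open>{i}\<close>; both constraints hold with equality, the first because the empty coalition has
  value 0.\<close>

lemma stable_structure_singletons:
  "stable_structure G (singletons G, \<lambda>i. coalition_value G {i})"
proof -
  have "(\<lambda>i. coalition_value G {i}) \<in> core G {i}" for i
    by (auto simp: core_def subset_singleton_iff coalition_value_def)
  then show ?thesis
    using partition_on_singletons by (auto simp: stable_structure_def singletons_def)
qed

section \<open>Enabled steps of the Core check and ordered enumeration\<close>

text \<open>A running check never gets stuck. By enumeration, either a subcoalition is still missing
  or the LP decides; by row generation, a solvable LP leads to a separation problem over the finite
  set \<open>Pow c\<close>, whose maximum is attained.\<close>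

lemma check_step_exists:
  assumes "finite c"
  shows "\<exists>es k. check_step G \<tau> c (Running S) es k"
proof (cases "card c \<le> \<tau>")
  case True
  then show ?thesis
    by (meson check_step.enumerate check_step.enumerate_yes check_step.enumerate_no)
next
  case False
  show ?thesis
  proof (cases "core_lp G c S = {}")
    case True
    with False show ?thesis
      by (meson check_step.generate_no not_le)
  next
    case nonempty: False
    then obtain w where w: "w \<in> core_lp G c S"
      by auto
    have "\<exists>s\<in>Pow c. \<forall>s'\<in>Pow c. excess G w s' \<le> excess G w s"
      using assms by (intro exists_max_on_finite) auto
    then obtain s where "most_violated G c w s"
      unfolding most_violated_def by auto
    then show ?thesis
      using False w by (meson check_step.generate check_step.generate_yes not_le)
  qed
qed

lemma exists_sorted_enumeration:
  fixes f :: "'a \<Rightarrow> real"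
  assumes "finite A"
  shows "\<exists>xs. distinct xs \<and> set xs = A \<and> sorted_wrt (\<lambda>x y. f x \<ge> f y) xs"
proof -
  obtain xs where xs: "set xs = A" "distinct xs"
    using finite_distinct_list[OF assms] by auto
  \<comment> \<open>\<open>sort_key\<close> sorts in ascending order, so the key is negated to
    obtain decreasing values of \<open>f\<close>.\<close>
  let ?ys = "sort_key (\<lambda>x. - f x) xs"
  have "sorted (map (\<lambda>x. - f x) ?ys)"
    by simp
  then have "sorted_wrt (\<lambda>x y. f x \<ge> f y) ?ys"
    by (simp add: sorted_wrt_map)
  then show ?thesis
    using xs by (intro exI[of _ ?ys]) simp
qed

section \<open>The potential and the invariant\<close>

text \<open>An upper bound on the checks still to be started when the current structure has
  \<open>m\<close> coalitions. Within an iteration it adds to the pending pairs the budget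
  \<open>m choose 3\<close> of a loop head with \<open>m - 1\<close> coalitions. A check in progress
  is already in the history and is not counted here.\<close>

fun remaining_checks :: "nat \<Rightarrow> 'i control \<Rightarrow> nat" where
  "remaining_checks m Loop = (m + 1) choose 3"
| "remaining_checks m (Pairs ps Q) = length ps + (m choose 3)"
| "remaining_checks m (Checking p ps Q k) = length ps + (m choose 3)"
| "remaining_checks m _ = 0"

text \<open>For a small coalition under check, \<open>length es = card S\<close> records that no
  subcoalition has been evaluated twice. Nothing is required once the check has answered, because
  the bound on its evaluations is kept separately in \<open>evals_bounded\<close>.\<close>

fun control_invariant ::
    "('i, 'j) game \<Rightarrow> nat \<Rightarrow> 'i set set \<Rightarrow> 'i set set \<times> ('i \<Rightarrow> real) \<Rightarrow>
     ('i set \<times> 'i set list) list \<Rightarrow> 'i control \<Rightarrow> bool" where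
  "control_invariant G \<tau> CS inc h (Pairs ps Q) \<longleftrightarrow> set ps \<union> Q \<subseteq> candidates G CS"
| "control_invariant G \<tau> CS inc h (Checking p ps Q k) \<longleftrightarrow>
     insert p (set ps \<union> Q) \<subseteq> candidates G CS \<and>
     (\<exists>es h'. h = (\<Union>p, es) # h' \<and>
       (\<forall>S. k = Running S \<longrightarrow> card (\<Union>p) \<le> \<tau> \<longrightarrow>
         S \<subseteq> {s. s \<noteq> {} \<and> s \<subset> \<Union>p} \<and> length es = card S))"
| "control_invariant G \<tau> CS inc h (Solving C) \<longleftrightarrow> partition_on (players G) C"
| "control_invariant G \<tau> CS inc h (Allocating C A v) \<longleftrightarrow>
     partition_on (players G) C \<and> A \<subseteq> C \<and> (\<forall>c\<in>C - A. v \<in> core G c)"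
| "control_invariant G \<tau> CS inc h (Returned r) \<longleftrightarrow> r = inc"
| "control_invariant G \<tau> CS inc h _ \<longleftrightarrow> True"

definition evals_bounded :: "nat \<Rightarrow> ('i set \<times> 'i set list) list \<Rightarrow> bool" where
  "evals_bounded \<tau> h \<longleftrightarrow> (\<forall>(c, es)\<in>set h. card c \<le> \<tau> \<longrightarrow> int (length es) \<le> 2 ^ \<tau> - 2)"

definition init_invariant :: "('i, 'j) game \<Rightarrow> 'i set \<Rightarrow> 'i state \<Rightarrow> bool" where
  "init_invariant G A \<sigma> \<longleftrightarrow> A \<subseteq> players G \<and> distinct (init_evals \<sigma>) \<and>
     set (init_evals \<sigma>) = (\<lambda>i. {i}) ` (players G - A)"

definition main_invariant :: "('i, 'j) game \<Rightarrow> nat \<Rightarrow> 'i state \<Rightarrow> bool" where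
  "main_invariant G \<tau> \<sigma> \<longleftrightarrow>
     init_invariant G {} \<sigma> \<and>
     cur_structure \<sigma> \<subseteq> Pow (players G) - {{}} \<and>
     pool \<sigma> \<subseteq> Pow (players G) - {{}} \<and>
     stable_structure G (incumbent \<sigma>) \<and>
     length (checks \<sigma>) + remaining_checks (card (cur_structure \<sigma>)) (control \<sigma>)
       \<le> (card (players G) + 1) choose 3 \<and>
     evals_bounded \<tau> (checks \<sigma>) \<and>
     control_invariant G \<tau> (cur_structure \<sigma>) (incumbent \<sigma>) (checks \<sigma>) (control \<sigma>)"

text \<open>Initialization is treated apart because \<open>incumbent\<close> is
  \<open>undefined\<close> in \<open>start\<close>, so stability can be claimed only
  afterwards.\<close>

definition invariant :: "('i, 'j) game \<Rightarrow> nat \<Rightarrow> 'i state \<Rightarrow> bool" where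
  "invariant G \<tau> \<sigma> \<longleftrightarrow>
     (case control \<sigma> of
        Init A \<Rightarrow> init_invariant G A \<sigma> \<and> checks \<sigma> = []
      | _ \<Rightarrow> main_invariant G \<tau> \<sigma>)"

lemma invariant_start: "invariant G \<tau> (start G)"
  by (simp add: invariant_def start_def init_invariant_def)

lemma invariant_Init:
  "control \<sigma> = Init A \<Longrightarrow> invariant G \<tau> \<sigma> \<longleftrightarrow> init_invariant G A \<sigma> \<and> checks \<sigma> = []"
  by (simp add: invariant_def)

lemma invariant_initialized: "initialized \<sigma> \<Longrightarrow> invariant G \<tau> \<sigma> \<longleftrightarrow> main_invariant G \<tau> \<sigma>"
  by (auto simp: invariant_def initialized_def split: control.splits)

text \<open>Shared by all exits from phase 1: the seed is a partition, and the potential drops to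
  0.\<close>

lemma main_invariant_begin_phase2:
  "main_invariant G \<tau> \<sigma> \<Longrightarrow> main_invariant G \<tau> (begin_phase2 G \<sigma>)"
  by (auto simp: main_invariant_def begin_phase2_def init_invariant_def partition_on_singletons)

lemma candidate_Union:
  assumes "CS \<subseteq> Pow N - {{}}" "p \<in> candidates G CS"
  shows "\<Union>p \<in> Pow N - {{}}"
proof -
  have p: "p \<subseteq> CS" "card p = 2"
    using assms(2) by (auto simp: candidates_def)
  then have "p \<noteq> {}"
    by auto
  then obtain c where "c \<in> p"
    by auto
  then show ?thesis
    using p(1) assms(1) by blast
qed

section \<open>Preservation of the invariant\<close>

lemma invariant_exec:
  assumes fin: "finite (players G)"
    and "exec G \<tau> T1 T2 \<sigma> \<sigma>'" and "invariant G \<tau> \<sigma>"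
  shows "invariant G \<tau> \<sigma>'"
proof -
  have fin_family: "finite P" if "P \<subseteq> Pow (players G) - {{}}" for P
    using that fin by (meson finite_Diff finite_Pow_iff finite_subset)
  have main: "main_invariant G \<tau> \<sigma>" if "\<And>A. control \<sigma> \<noteq> Init A"
    using that \<open>invariant G \<tau> \<sigma>\<close> by (simp add: initialized_def invariant_initialized)
  from assms(2) show ?thesis
  proof cases
    case (init_eval A i)
    then have inv: "init_invariant G A \<sigma>" "checks \<sigma> = []"
      using \<open>invariant G \<tau> \<sigma>\<close> by (auto simp: invariant_Init)
    then show ?thesis
      using init_eval by (auto simp: invariant_def init_invariant_def)
  next
    case init_done
    then have "init_invariant G {} \<sigma>" "checks \<sigma> = []"
      using \<open>invariant G \<tau> \<sigma>\<close> by (auto simp: invariant_Init)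
    \<comment> \<open>The first loop head thus has \<open>card (players G)\<close> coalitions, and
      its potential equals the claimed bound exactly.\<close>
    moreover have "card (singletons G) = card (players G)"
      by (simp add: singletons_eq_image card_image)
    moreover have "singletons G \<subseteq> Pow (players G) - {{}}"
      by (auto simp: singletons_def)
    ultimately show ?thesis
      using init_done stable_structure_singletons[of G]
      by (simp add: invariant_def main_invariant_def init_invariant_def evals_bounded_def)
  next
    case (phase1_timeout ps Q)
    then show ?thesis
      using main main_invariant_begin_phase2[of G \<tau> \<sigma>]
      by (auto simp: invariant_def begin_phase2_def)
  next
    case loop_exit
    then show ?thesis
      using main main_invariant_begin_phase2[of G \<tau> \<sigma>]
      by (auto simp: invariant_def begin_phase2_def)
  next
    case (loop_enter ps)
    let ?m = "card (cur_structure \<sigma>)"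
    have inv: "main_invariant G \<tau> \<sigma>"
      using main loop_enter by simp
    then have "finite (cur_structure \<sigma>)"
      by (intro fin_family) (simp add: main_invariant_def)
    then have "length ps \<le> ?m choose 2"
      using loop_enter card_candidates_le distinct_card by metis
    \<comment> \<open>Pascal's rule splits the potential into the checks of this iteration and those
      of later ones.\<close>
    moreover have "(?m + 1) choose 3 = (?m choose 2) + (?m choose 3)"
      by (simp add: numeral_3_eq_3 numeral_2_eq_2)
    ultimately show ?thesis
      using inv loop_enter by (auto simp: invariant_def main_invariant_def init_invariant_def)
  next
    case (check_begin p ps Q)
    have inv: "main_invariant G \<tau> \<sigma>"
      using main check_begin by simp
    then have "\<Union>p \<in> Pow (players G) - {{}}"
      using check_begin by (intro candidate_Union[of "cur_structure \<sigma>"]) (auto simp: main_invariant_def)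
    then have "finite (\<Union>p)" "\<Union>p \<noteq> {}"
      using fin finite_subset by auto
    \<comment> \<open>The new history entry has no evaluations yet, so its bound amounts to
      nonnegativity.\<close>
    then have "0 \<le> (2 ^ \<tau> - 2 :: int)" if "card (\<Union>p) \<le> \<tau>"
      using card_proper_nonempty_subsets_le[of "\<Union>p" \<tau> "{}"] that by simp
    then show ?thesis
      using inv check_begin
      by (auto simp: invariant_def main_invariant_def init_invariant_def evals_bounded_def)
  next
    case (check_continue p ps Q k es k')
    have inv: "main_invariant G \<tau> \<sigma>"
      using main check_continue by simp
    then obtain es0 h where h: "checks \<sigma> = (\<Union>p, es0) # h"
      and bounded: "evals_bounded \<tau> (checks \<sigma>)"
      and enum: "\<And>S. k = Running S \<Longrightarrow> card (\<Union>p) \<le> \<tau> \<Longrightarrow>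
        S \<subseteq> {s. s \<noteq> {} \<and> s \<subset> \<Union>p} \<and> length es0 = card S"
      using check_continue by (auto simp: main_invariant_def)
    have "\<Union>p \<in> Pow (players G) - {{}}"
      using inv check_continue
      by (intro candidate_Union[of "cur_structure \<sigma>"]) (auto simp: main_invariant_def)
    then have U: "finite (\<Union>p)" "\<Union>p \<noteq> {}"
      using fin finite_subset by auto
    \<comment> \<open>Only \<open>enumerate\<close> leaves a small coalition running; it evaluates
      one \<open>s\<close> that is not yet collected, so both counts grow by one.\<close>
    have enum': "S \<subseteq> {s. s \<noteq> {} \<and> s \<subset> \<Union>p} \<and> length (es @ es0) = card S"
      if "k' = Running S" "card (\<Union>p) \<le> \<tau>" for S
      using \<open>check_step G \<tau> (\<Union>p) k es k'\<close> that(1)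
    proof cases
      case (enumerate s S0)
      then have S0: "S0 \<subseteq> {s. s \<noteq> {} \<and> s \<subset> \<Union>p}" "length es0 = card S0"
        using enum that by auto
      moreover have "finite S0"
        using S0(1) U(1) by (auto intro: finite_subset[of _ "Pow (\<Union>p)"])
      ultimately show ?thesis
        using enumerate that by auto
    qed (use that in auto)
    have "card (\<Union>p) \<le> \<tau> \<longrightarrow> int (length (es @ es0)) \<le> 2 ^ \<tau> - 2"
    proof (intro impI)
      assume le: "card (\<Union>p) \<le> \<tau>"
      show "int (length (es @ es0)) \<le> 2 ^ \<tau> - 2"
      proof (cases k')
        case (Running S)
        then show ?thesis
          using card_proper_nonempty_subsets_le[OF U le, of S] enum'[OF Running le] by simp
      next
        case (Answered r)
        \<comment> \<open>Under enumeration an answer comes without a further evaluation;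
          \<open>generate_yes\<close>, which makes one, needs a coalition larger than
          \<tau>.\<close>
        have "es = []"
          using \<open>check_step G \<tau> (\<Union>p) k es k'\<close> Answered le by cases auto
        then show ?thesis
          using bounded le h by (auto simp: evals_bounded_def)
      qed
    qed
    then have "evals_bounded \<tau> ((\<Union>p, es @ es0) # h)"
      using bounded h by (auto simp: evals_bounded_def)
    then show ?thesis
      using inv check_continue h enum'
      by (auto simp: invariant_def main_invariant_def init_invariant_def)
  next
    case (check_timeout p ps Q S)
    then show ?thesis
      using main by (auto simp: invariant_def main_invariant_def init_invariant_def)
  next
    case (check_passed p ps Q)
    have inv: "main_invariant G \<tau> \<sigma>"
      using main check_passed by simp
    then have "\<Union>p \<in> Pow (players G) - {{}}"
      using check_passed by (intro candidate_Union[of "cur_structure \<sigma>"]) (auto simp: main_invariant_def)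
    then show ?thesis
      using inv check_passed by (auto simp: invariant_def main_invariant_def init_invariant_def)
  next
    case (check_failed p ps Q r)
    then show ?thesis
      using main by (auto simp: invariant_def main_invariant_def init_invariant_def)
  next
    case none_passed
    then show ?thesis
      using main main_invariant_begin_phase2[of G \<tau> \<sigma>]
      by (auto simp: invariant_def begin_phase2_def)
  next
    case (merge Q p)
    let ?CS = "cur_structure \<sigma>"
    let ?CS' = "insert (\<Union>p) (?CS - p)"
    have inv: "main_invariant G \<tau> \<sigma>"
      using main merge by simp
    then have CS: "?CS \<subseteq> Pow (players G) - {{}}" and p: "p \<in> candidates G ?CS"
      using merge by (auto simp: main_invariant_def)
    have "card ?CS' + 1 \<le> card ?CS"
      using card_merge_less[OF fin_family[OF CS] p, of "\<Union>p"] by simp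
    \<comment> \<open>The left side is the potential at the next loop head, the right side the
      potential after all pairs have been processed.\<close>
    then have "(card ?CS' + 1) choose 3 \<le> card ?CS choose 3"
      by (rule binomial_right_mono)
    moreover have "?CS' \<subseteq> Pow (players G) - {{}}"
      using CS candidate_Union[OF CS p] by auto
    ultimately show ?thesis
      using inv merge by (simp add: invariant_def main_invariant_def init_invariant_def)
  next
    case (spp_improve C C')
    have inv: "main_invariant G \<tau> \<sigma>"
      using main spp_improve by simp
    then have pool: "pool \<sigma> \<subseteq> Pow (players G) - {{}}"
      by (simp add: main_invariant_def)
    have "partition_on (players G) C'"
      using spp_feasible_partition[OF fin_family[OF pool] pool] spp_improve by blast
    then show ?thesis
      using inv spp_improve by (auto simp: invariant_def main_invariant_def init_invariant_def)
  next
    case (spp_done C)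
    then show ?thesis
      using main by (auto simp: invariant_def main_invariant_def init_invariant_def)
  next
    case (allocate C A v c w)
    have inv: "main_invariant G \<tau> \<sigma>"
      using main allocate by simp
    then have part: "partition_on (players G) C" and A: "A \<subseteq> C"
      and v: "\<And>d. d \<in> C - A \<Longrightarrow> v \<in> core G d"
      using allocate by (auto simp: main_invariant_def)
    let ?v = "\<lambda>i. if i \<in> c then w i else v i"
    have "?v \<in> core G d" if "d \<in> C - (A - {c})" for d
    proof (cases "d = c")
      case True
      then show ?thesis
        using \<open>w \<in> core G c\<close> core_cong[of d ?v w G] by simp
    next
      case False
      \<comment> \<open>Both are blocks of the partition \<open>C\<close>, so overwriting the
        payoffs on \<open>c\<close> leaves those of \<open>d\<close> unchanged.\<close>
      then have "d \<inter> c = {}"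
        using partition_onD2[OF part] that A allocate(3) by (auto simp: disjoint_def)
      then have "?v \<in> core G d \<longleftrightarrow> v \<in> core G d"
        by (intro core_cong) auto
      then show ?thesis
        using v that False by auto
    qed
    then show ?thesis
      using inv allocate by (auto simp: invariant_def main_invariant_def init_invariant_def)
  next
    case (allocate_done C v)
    then show ?thesis
      using main
      by (auto simp: invariant_def main_invariant_def init_invariant_def stable_structure_def)
  next
    case (allocate_abandon C A v)
    then show ?thesis
      using main by (auto simp: invariant_def main_invariant_def init_invariant_def)
  next
    case return
    then show ?thesis
      using main by (auto simp: invariant_def main_invariant_def init_invariant_def)
  qed
qed

text \<open>The invariant does not read the clock, so it survives arbitrary delays.\<close>

lemma invariant_clock: "invariant G \<tau> (\<sigma>\<lparr>clock := t\<rparr>) \<longleftrightarrow> invariant G \<tau> \<sigma>"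
  by (simp add: invariant_def main_invariant_def init_invariant_def split: control.split)

lemma invariant_reachable:
  assumes "finite (players G)" "reachable G \<tau> T1 T2 \<sigma>"
  shows "invariant G \<tau> \<sigma>"
  using assms(2)
  by induction (auto simp: invariant_start invariant_clock intro: invariant_exec[OF assms(1)])

section \<open>Progress until a result is returned\<close>

text \<open>At each control point the guards of the rules are exhaustive: budget left or expired,
  pairs left or not, optimum reached or not. Finiteness supplies the sorted list of pairs, the
  passing pair of largest gain and the most violated subcoalition.\<close>

lemma exec_progress:
  assumes fin: "finite (players G)" and "invariant G \<tau> \<sigma>"
    and "\<And>r. control \<sigma> \<noteq> Returned r"
  shows "\<exists>\<sigma>'. exec G \<tau> T1 T2 \<sigma> \<sigma>'"
proof -
  have fin_CS: "finite (cur_structure \<sigma>)" if "main_invariant G \<tau> \<sigma>"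
    using that fin by (auto simp: main_invariant_def intro: finite_subset[of _ "Pow (players G)"])
  show ?thesis
  proof (cases "control \<sigma>")
    case (Init A)
    then show ?thesis
      using exec.init_done exec.init_eval by (metis all_not_in_conv)
  next
    case Loop
    then have "main_invariant G \<tau> \<sigma>"
      using assms(2) by (simp add: invariant_def)
    then have "finite (candidates G (cur_structure \<sigma>))"
      using fin_CS candidates_finite by blast
    then obtain ps where "distinct ps" "set ps = candidates G (cur_structure \<sigma>)"
      "sorted_wrt (\<lambda>p q. gain G p \<ge> gain G q) ps"
      using exists_sorted_enumeration by blast
    then show ?thesis
      using Loop exec.loop_enter exec.loop_exit exec.phase1_timeout
      by (metis not_le)
  next
    case (Pairs ps Q)
    then have inv: "main_invariant G \<tau> \<sigma>"
      using assms(2) by (simp add: invariant_def)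
    show ?thesis
    proof (cases "clock \<sigma> < T1")
      case False
      then show ?thesis
        using Pairs exec.phase1_timeout by (metis not_le)
    next
      case time: True
      show ?thesis
      proof (cases ps)
        case (Cons p ps')
        then show ?thesis
          using Pairs time exec.check_begin by blast
      next
        case Nil
        show ?thesis
        proof (cases "Q = {}")
          case True
          then show ?thesis
            using Pairs Nil time exec.none_passed by blast
        next
          case False
          have "Q \<subseteq> candidates G (cur_structure \<sigma>)"
            using inv Pairs by (simp add: main_invariant_def)
          then have "finite Q"
            using candidates_finite[OF fin_CS[OF inv]] finite_subset by blast
          then obtain p where "p \<in> Q" "\<forall>q\<in>Q. gain G q \<le> gain G p"
            using exists_max_on_finite False by blast
          then show ?thesis
            using Pairs Nil time exec.merge by blast
        qed
      qed
    qed
  next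
    case (Checking p ps Q k)
    then have inv: "main_invariant G \<tau> \<sigma>"
      using assms(2) by (simp add: invariant_def)
    then have "\<Union>p \<in> Pow (players G) - {{}}"
      using Checking by (intro candidate_Union[of "cur_structure \<sigma>"]) (auto simp: main_invariant_def)
    then have "finite (\<Union>p)"
      using fin finite_subset by auto
    show ?thesis
    proof (cases k)
      case (Running S)
      obtain es k' where step: "check_step G \<tau> (\<Union>p) (Running S) es k'"
        using check_step_exists[OF \<open>finite (\<Union>p)\<close>] by blast
      show ?thesis
      proof (cases "clock \<sigma> < T1")
        case True
        then show ?thesis
          using step Checking Running exec.check_continue by blast
      next
        case False
        then show ?thesis
          using Checking Running exec.check_timeout by (metis not_le)
      qed
    next
      case (Answered r)
      then show ?thesis
        using Checking exec.check_passed exec.check_failed by metis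
    qed
  next
    case (Solving C)
    then show ?thesis
      \<comment> \<open>If time remains and \<open>C\<close> is not optimal, a strictly better
        feasible \<open>C'\<close> exists and \<open>spp_improve\<close> applies.\<close>
      using exec.spp_improve exec.spp_done by (metis not_le)
  next
    case (Allocating C A v)
    then show ?thesis
      by (cases "A = {}") (use exec.allocate_done exec.allocate_abandon in blast)+
  next
    case Closing
    then show ?thesis
      using exec.return by blast
  next
    case (Returned r)
    then show ?thesis
      using assms(3) by simp
  qed
qed

section \<open>Guarantees at every reachable state\<close>

theorem proposition8:
  fixes G :: "('i, 'j) game" and \<tau> :: nat and T1 T2 :: real
  assumes "pooling_game G" and "T1 \<ge> 0" and "T2 \<ge> 0"
  shows "\<forall>\<sigma>. reachable G \<tau> T1 T2 \<sigma> \<longrightarrow>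
    (initialized \<sigma> \<longrightarrow>
       distinct (init_evals \<sigma>) \<and> set (init_evals \<sigma>) = {{i} | i. i \<in> players G} \<and>
       length (init_evals \<sigma>) = card (players G)) \<and>
    (initialized \<sigma> \<longrightarrow> stable_structure G (incumbent \<sigma>)) \<and>
    (\<forall>r. control \<sigma> = Returned r \<longrightarrow> r = incumbent \<sigma>) \<and>
    (stopped G \<tau> T1 T2 \<sigma> \<longrightarrow> initialized \<sigma> \<and> control \<sigma> = Returned (incumbent \<sigma>)) \<and>
    length (checks \<sigma>) \<le> (card (players G) + 1) choose 3 \<and>
    (\<forall>(c, es)\<in>set (checks \<sigma>). card c \<le> \<tau> \<longrightarrow> int (length es) \<le> 2 ^ \<tau> - 2)"
proof (intro allI impI)
  fix \<sigma>
  assume reach: "reachable G \<tau> T1 T2 \<sigma>"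
  have fin: "finite (players G)"
    using \<open>pooling_game G\<close> by (rule pooling_game.finite_players)
  have inv: "invariant G \<tau> \<sigma>"
    using invariant_reachable[OF fin reach] .
  have main: "main_invariant G \<tau> \<sigma>" if "initialized \<sigma>"
    using inv that by (simp add: invariant_initialized)
  have initial: "init_invariant G {} \<sigma>" if "initialized \<sigma>"
    using main[OF that] by (simp add: main_invariant_def)
  have evals: "distinct (init_evals \<sigma>) \<and> set (init_evals \<sigma>) = {{i} | i. i \<in> players G} \<and>
       length (init_evals \<sigma>) = card (players G)" if "initialized \<sigma>"
  proof -
    have d: "distinct (init_evals \<sigma>)" and s: "set (init_evals \<sigma>) = (\<lambda>i. {i}) ` players G"
      using initial[OF that] by (auto simp: init_invariant_def)
    have "length (init_evals \<sigma>) = card (players G)"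
      using distinct_card[OF d] s by (simp add: card_image)
    then show ?thesis
      using d s by auto
  qed
  have stable: "stable_structure G (incumbent \<sigma>)" if "initialized \<sigma>"
    using main[OF that] by (simp add: main_invariant_def)
  have returned: "initialized \<sigma> \<and> r = incumbent \<sigma>" if "control \<sigma> = Returned r" for r
    using that inv by (simp add: invariant_def main_invariant_def initialized_def)
  \<comment> \<open>By progress, a state without successor can only be a returned one.\<close>
  have stop: "initialized \<sigma> \<and> control \<sigma> = Returned (incumbent \<sigma>)" if "stopped G \<tau> T1 T2 \<sigma>"
    using exec_progress[OF fin inv] that returned unfolding stopped_def by metis
  \<comment> \<open>The two bounds are claimed during initialization as well, where the history of
    checks is still empty.\<close>
  have history: "length (checks \<sigma>) \<le> (card (players G) + 1) choose 3 \<and> evals_bounded \<tau> (checks \<sigma>)"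
  proof (cases "initialized \<sigma>")
    case True
    then show ?thesis
      using main by (simp add: main_invariant_def)
  next
    case False
    then have "checks \<sigma> = []"
      using inv by (auto simp: initialized_def invariant_Init)
    then show ?thesis
      by (simp add: evals_bounded_def)
  qed
  show "(initialized \<sigma> \<longrightarrow>
       distinct (init_evals \<sigma>) \<and> set (init_evals \<sigma>) = {{i} | i. i \<in> players G} \<and>
       length (init_evals \<sigma>) = card (players G)) \<and>
    (initialized \<sigma> \<longrightarrow> stable_structure G (incumbent \<sigma>)) \<and>
    (\<forall>r. control \<sigma> = Returned r \<longrightarrow> r = incumbent \<sigma>) \<and>
    (stopped G \<tau> T1 T2 \<sigma> \<longrightarrow> initialized \<sigma> \<and> control \<sigma> = Returned (incumbent \<sigma>)) \<and>
    length (checks \<sigma>) \<le> (card (players G) + 1) choose 3 \<and>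
    (\<forall>(c, es)\<in>set (checks \<sigma>). card c \<le> \<tau> \<longrightarrow> int (length es) \<le> 2 ^ \<tau> - 2)"
    using evals stable returned stop history unfolding evals_bounded_def by blast
qed

end
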